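(* Every infinite compact metrisable topological space $X$ contains a non-trivial convergent sequence: there exist a sequence $(a_n)_{n<\omega}$ of points of $X$ that is not eventually constant and a point $a\in X$ such that $a_n\to a$.
   Context: A topological space is metrisable if there is a metric on it whose open balls form a base of its topology. A sequence $(a_n)$ converges to $a$ if every open neighbourhood of $a$ contains all but finitely many terms of the sequence. A sequence is trivial if it is eventually constant, and non-trivial otherwise. *)

theory Defs
  imports "HOL-Analysis.Analysis"
begin

definition trivial_sequence :: "(nat \<Rightarrow> 'a) \<Rightarrow> bool" where
  "trivial_sequence a \<longleftrightarrow> (\<exists>c. \<forall>\<^sub>F n in sequentially. a n = c)"

end

theory Submission imports Defs begin

text \<open>An infinite space contains a sequence of pairwise distinct points. In a compact metric
  space it has a convergent subsequence (\<open>compact_space_sequentially\<close>), whose terms are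
  still pairwise distinct, so it cannot be eventually constant
  (\<open>inj_not_trivial_sequence\<close>).\<close>

lemma inj_not_trivial_sequence:
  assumes "inj a"
  shows "\<not> trivial_sequence a"
proof
  assume "trivial_sequence a"
  then obtain c N where "\<And>n. n \<ge> N \<Longrightarrow> a n = c"
    unfolding trivial_sequence_def eventually_sequentially by blast
  then have "a N = a (Suc N)" by simp
  with assms show False by (simp add: inj_eq)
qed

theorem theorem2p3p4:
  fixes X :: "'a topology"
  assumes "infinite (topspace X)"
    and "compact_space X"
    and "metrizable_space X"
  shows "\<exists>(a :: nat \<Rightarrow> 'a) l. range a \<subseteq> topspace X \<and> l \<in> topspace X \<and>
           \<not> trivial_sequence a \<and> limitin X a l sequentially"
proof -
  obtain M d where "Metric_space M d" and X: "X = Metric_space.mtopology M d"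
    using assms(3) unfolding metrizable_space_def by blast
  interpret Metric_space M d by fact
  have top: "topspace X = M" by (simp add: X)
  \<comment> \<open>Injectivity is demanded here because, unlike mere non-triviality, it passes to
    every subsequence.\<close>
  obtain s :: "nat \<Rightarrow> 'a" where s: "inj s" "range s \<subseteq> M"
    using infinite_countable_subset[OF assms(1)] top by auto
  \<comment> \<open>The metric \<open>d\<close> enters here: compactness of \<open>mtopology\<close>
    amounts to sequential compactness of \<open>M\<close>.\<close>
  have "\<exists>l r. l \<in> M \<and> strict_mono r \<and> limitin X (s \<circ> r) l sequentially"
    using assms(2) s(2) unfolding X compact_space_sequentially by blast
  then obtain l r where l: "l \<in> M" "strict_mono (r :: nat \<Rightarrow> nat)"
    "limitin X (s \<circ> r) l sequentially" by blast
  \<comment> \<open>A strictly increasing choice of indices never repeats one.\<close>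
  have "inj (s \<circ> r)"
    using s(1) strict_mono_imp_inj_on[OF l(2)] by (rule inj_compose)
  then have "\<not> trivial_sequence (s \<circ> r)" by (rule inj_not_trivial_sequence)
  moreover have "range (s \<circ> r) \<subseteq> topspace X" using s(2) top by auto
  ultimately show ?thesis using l top by blast
qed

end
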